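(* Let $V$ be an ungraded vector space considered as a graded space concentrated in degree $0$. Then a Nijenhuis associative algebra structure on $V$ is equivalent to a Maurer-Cartan element in the $L_\infty$-algebra $\mathfrak{C}_{\mathrm{NjA}}(V)$; i.e. Nijenhuis associative algebra structures $(m,P)$ on $V$ correspond bijectively to Maurer-Cartan elements of $\mathfrak{C}_{\mathrm{NjA}}(V)$, under the identifications $m=s^{-1}\circ b_2\circ s^{\otimes 2}$, $P=R_1\circ s$ of a pair $(m,P)$ with a degree $-1$ element $(b_2,R_1)\in\mathrm{Hom}((sV)^{\otimes 2},sV)\oplus\mathrm{Hom}(sV,V)$.
   Context: $\mathbf{k}$ is a field of characteristic $0$; gradings are homological; $sV$ is the suspension, $(sV)_n=V_{n-1}$, and $s:V\to sV$ has degree $1$, $s^{-1}$ degree $-1$; Koszul signs are used throughout. A Nijenhuis associative algebra $(A,m,P)$ is an associative algebra $(A,m)$ with a linear map $P:A\to A$ such that $m\circ(P\otimes P)=P\circ\big(m\circ(P\otimes\mathrm{Id})+m\circ(\mathrm{Id}\otimes P)-P\circ m\big)$. Brace operations: for homogeneous $f:(sV)^{\otimes m}\to sV$ and $g_i:(sV)^{\otimes n_i}\to sV$, $f\{g_1,\dots,g_k\}$ is the sum over all ways of inserting $g_1,\dots,g_k$ in this order in distinct inputs of $f$: $\sum f\circ(\mathrm{id}^{\otimes a_0}\otimes g_1\otimes\mathrm{id}^{\otimes a_1}\otimes\cdots\otimes g_k\otimes\mathrm{id}^{\otimes a_k})$, over $a_0+\cdots+a_k+k=m$; it is $0$ if $k>m$,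 and $f\{\}=f$. The Gerstenhaber bracket is $[f,g]_{\mathrm G}=f\{g\}-(-1)^{|f||g|}g\{f\}$. The $L_\infty$-algebra: with $\overline{T^c}(sV)=\bigoplus_{n\geq 1}(sV)^{\otimes n}$, put $\mathfrak{C}_{\mathrm{Alg}}(V)=\mathrm{Hom}(\overline{T^c}(sV),sV)$, $\mathfrak{C}_{\mathrm{NjO}}(V)=\mathrm{Hom}(\overline{T^c}(sV),V)$ and $\mathfrak{C}_{\mathrm{NjA}}(V)=\mathfrak{C}_{\mathrm{Alg}}(V)\oplus\mathfrak{C}_{\mathrm{NjO}}(V)$, graded by the degree of maps. Elements of $\mathfrak{C}_{\mathrm{Alg}}(V)$ are written $sh$ with $|sh|=|h|+1$; for $g\in\mathfrak{C}_{\mathrm{NjO}}(V)$, $sg$ is $s\circ g$. The operations $l_n$ (of degree $n-2$, graded skew-symmetric) are: (i) $l_2(sf\otimes sh)=[sf,sh]_{\mathrm G}$ for $sf,sh\in\mathfrak{C}_{\mathrm{Alg}}(V)$. (ii) for $n\geq 1$, $sh\in\mathrm{Hom}((sV)^{\otimes n},sV)$ and $g_1,\dots,g_n\in\mathfrak{C}_{\mathrm{NjO}}(V)$, $$l_{n+1}(sh\otimes g_1\otimes\cdots\otimes g_n)=\sum_{\sigma\in\mathbb{S}_n}(-1)^{\eta}\Big(\sum_{k=0}^{n}(-1)^{\xi}s^{-1}\circ(sg_{\sigma(1)})\{\cdots\{sg_{\sigma(k)}\{sh\{sg_{\sigma(k+1)},\dots,sg_{\sigma(n)}\}\}\}\cdots\}\Big),$$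 where $(-1)^\eta=\chi(\sigma;g_1,\dots,g_n)(-1)^{n(|h|+1)+\sum_{k=1}^{n-1}\sum_{j=1}^{k}|g_{\sigma(j)}|}$, $\chi$ is the sign of $\sigma$ times the Koszul sign, and $(-1)^\xi=(-1)^{(|h|+1)\sum_{i=1}^{k}(|g_{\sigma(i)}|+1)+k}$. (iii) $l_{n+1}(g_1\otimes\cdots\otimes g_k\otimes sh\otimes g_{k+1}\otimes\cdots\otimes g_n)=(-1)^{(|h|+1)(\sum_{j=1}^{k}|g_j|)+k}\,l_{n+1}(sh\otimes g_1\otimes\cdots\otimes g_n)$ for $1\leq k\leq n$ and $sh$ of arity $n$. (iv) All other components vanish. A Maurer-Cartan element is a degree $-1$ element $\alpha$ with $\sum_{n\geq 1}\frac{1}{n!}(-1)^{\frac{n(n-1)}{2}}l_n(\alpha^{\otimes n})=0$. *)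

theory Defs
  imports Complex_Main "HOL-Combinatorics.Permutations"
begin

text \<open>A graded vector space is a family \<open>V :: int \<Rightarrow> 'v set\<close> of subspaces of one ambient space. A
  homogeneous element is a pair \<open>(d, x)\<close> with \<open>x \<in> V d\<close>; a word is a list of homogeneous elements
  and stands for a decomposable tensor. A linear map on the reduced tensor coalgebra is given
  by its values on nonempty words, multilinear in each arity and for each tuple of degrees.\<close>

type_synonym 'v word = "(int \<times> 'v) list"
type_synonym 'v fn = "'v word \<Rightarrow> 'v"

text \<open>A homogeneous map together with its degree.\<close>
type_synonym 'v hmap = "int \<times> 'v fn"

definition graded_space :: "('k::field \<Rightarrow> 'v::ab_group_add \<Rightarrow> 'v) \<Rightarrow> (int \<Rightarrow> 'v set) \<Rightarrow> bool" where
  "graded_space scale V \<longleftrightarrow> vector_space scale \<and> (\<forall>n. module.subspace scale (V n))"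

definition concentrated0 :: "int \<Rightarrow> 'v::ab_group_add set" where
  "concentrated0 n = (if n = 0 then UNIV else {0})"

lemma graded_space_concentrated0:
  assumes "vector_space scale"
  shows "graded_space scale concentrated0"
proof -
  interpret vector_space scale by fact
  show ?thesis
    unfolding graded_space_def concentrated0_def using assms by (auto simp: subspace_def)
qed

definition susp :: "(int \<Rightarrow> 'v set) \<Rightarrow> int \<Rightarrow> 'v set" where
  "susp V n = V (n - 1)"

definition words :: "(int \<Rightarrow> 'v set) \<Rightarrow> 'v word set" where
  "words V = {xs. xs \<noteq> [] \<and> (\<forall>(d, x) \<in> set xs. x \<in> V d)}"

definition deg :: "'v word \<Rightarrow> int" where
  "deg xs = sum_list (map fst xs)"

text \<open>The degree \<open>e\<close> part of Hom from the reduced tensor coalgebra on \<open>V\<close> to \<open>W\<close>. Maps are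
  normalised to be zero outside \<open>words V\<close>, so that equality of functions is equality of maps.\<close>
definition graded_hom ::
  "('k::field \<Rightarrow> 'v::ab_group_add \<Rightarrow> 'v) \<Rightarrow> (int \<Rightarrow> 'v set) \<Rightarrow> (int \<Rightarrow> 'v set) \<Rightarrow> int \<Rightarrow> 'v fn set" where
  "graded_hom scale V W e = {f.
     (\<forall>xs. xs \<notin> words V \<longrightarrow> f xs = 0) \<and>
     (\<forall>xs \<in> words V. f xs \<in> W (deg xs + e)) \<and>
     (\<forall>us d x y vs. us @ (d, x) # vs \<in> words V \<and> us @ (d, y) # vs \<in> words V \<longrightarrow>
        f (us @ (d, x + y) # vs) = f (us @ (d, x) # vs) + f (us @ (d, y) # vs)) \<and>
     (\<forall>us d c x vs. us @ (d, x) # vs \<in> words V \<longrightarrow>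
        f (us @ (d, scale c x) # vs) = scale c (f (us @ (d, x) # vs)))}"

text \<open>\<open>ksgn e x\<close> is $(-1)^e x$.\<close>
definition ksgn :: "int \<Rightarrow> 'v::ab_group_add \<Rightarrow> 'v" where
  "ksgn e x = (if even e then x else - x)"

definition arity_part :: "nat \<Rightarrow> 'v::zero fn \<Rightarrow> 'v fn" where
  "arity_part n f = (\<lambda>xs. if length xs = n then f xs else 0)"

text \<open>Since \<open>(sV)\<^sub>n\<close> and \<open>V\<^sub>n\<^sub>-\<^sub>1\<close> are the same subset of the ambient space, \<open>s\<close> only shifts the
  degree of a homogeneous element.\<close>
definition h_id :: "'v hmap" where
  "h_id = (0, \<lambda>xs. snd (hd xs))"

definition h_s :: "'v hmap" where
  "h_s = (1, \<lambda>xs. snd (hd xs))"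

text \<open>Postcomposition with \<open>s\<close> and with its inverse; no Koszul sign arises.\<close>
definition s_post :: "'v hmap \<Rightarrow> 'v hmap" where
  "s_post f = (fst f + 1, snd f)"

definition s_inv_post :: "'v hmap \<Rightarrow> 'v hmap" where
  "s_inv_post f = (fst f - 1, snd f)"

text \<open>Evaluation of a tensor product of maps, each given with the arity in which it is used, on a
  word; the first component of the result is the exponent of the Koszul sign:
  $(\varphi\otimes\Phi)(u\otimes v) = (-1)^{|\Phi||u|}\varphi(u)\otimes\Phi(v)$.\<close>
fun tensor_apply :: "(nat \<times> 'v hmap) list \<Rightarrow> 'v word \<Rightarrow> int \<times> 'v word" where
  "tensor_apply [] xs = (0, [])"
| "tensor_apply ((n, \<phi>) # \<phi>s) xs =
     (let u = take n xs; (c, ys) = tensor_apply \<phi>s (drop n xs)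
      in (c + (\<Sum>(m, \<psi>) \<leftarrow> \<phi>s. fst \<psi>) * deg u, (fst \<phi> + deg u, snd \<phi> u) # ys))"

text \<open>$f\circ(\varphi_1\otimes\cdots\otimes\varphi_r)$.\<close>
definition compose :: "'v::ab_group_add hmap \<Rightarrow> (nat \<times> 'v hmap) list \<Rightarrow> 'v hmap" where
  "compose f \<phi>s = (fst f + (\<Sum>(m, \<psi>) \<leftarrow> \<phi>s. fst \<psi>),
     \<lambda>xs. if length xs = sum_list (map fst \<phi>s)
          then (let (c, ys) = tensor_apply \<phi>s xs in ksgn c (snd f ys)) else 0)"

text \<open>$\mathrm{id}^{\otimes a_0}\otimes g_1\otimes\mathrm{id}^{\otimes a_1}\otimes\cdots\otimes g_k\otimes\mathrm{id}^{\otimes a_k}$\<close>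
fun insertion :: "nat list \<Rightarrow> (nat \<times> 'v hmap) list \<Rightarrow> (nat \<times> 'v hmap) list" where
  "insertion [] gs = gs"
| "insertion (a # as) [] = replicate a (1, h_id)"
| "insertion (a # as) (g # gs) = replicate a (1, h_id) @ g # insertion as gs"

text \<open>Arguments are families of maps of all arities, so besides the positions one also sums over
  the arities \<open>ns\<close> of the components of \<open>gs\<close>; on a given word only those arities occur which add up
  to its length.\<close>
definition insertions :: "nat \<Rightarrow> nat \<Rightarrow> (nat list \<times> nat list) set" where
  "insertions k N = {(as, ns). length as = Suc k \<and> length ns = k \<and> (\<forall>n \<in> set ns. 1 \<le> n) \<and>
     sum_list as + sum_list ns = N}"

lemma finite_insertions: "finite (insertions k N)"
proof (rule finite_subset)
  show "insertions k N \<subseteq> {as. set as \<subseteq> {..N} \<and> length as = Suc k} \<times> {ns. set ns \<subseteq> {..N} \<and> length ns = k}"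
    unfolding insertions_def by (auto dest!: member_le_sum_list)
  show "finite ({as. set as \<subseteq> {..N} \<and> length as = Suc k} \<times> {ns. set ns \<subseteq> {..N} \<and> length ns = k})"
    by (intro finite_cartesian_product finite_lists_length_eq) auto
qed

definition brace :: "'v::ab_group_add hmap \<Rightarrow> 'v hmap list \<Rightarrow> 'v hmap" where
  "brace f gs = (fst f + sum_list (map fst gs),
     \<lambda>xs. \<Sum>(as, ns) \<in> insertions (length gs) (length xs). snd (compose f (insertion as (zip ns gs))) xs)"

definition gerst :: "'v::ab_group_add hmap \<Rightarrow> 'v hmap \<Rightarrow> 'v hmap" where
  "gerst f g = (fst f + fst g,
     \<lambda>xs. snd (brace f [g]) xs - ksgn (fst f * fst g) (snd (brace g [f]) xs))"

text \<open>An element of $\mathfrak{C}_{\mathrm{Alg}}(V)\oplus\mathfrak{C}_{\mathrm{NjO}}(V)$; its first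
  component is \<open>sh\<close> (not \<open>h\<close>).\<close>
type_synonym 'v cochain = "'v fn \<times> 'v fn"

definition C_NjA :: "('k::field \<Rightarrow> 'v::ab_group_add \<Rightarrow> 'v) \<Rightarrow> (int \<Rightarrow> 'v set) \<Rightarrow> int \<Rightarrow> 'v cochain set" where
  "C_NjA scale V e = graded_hom scale (susp V) (susp V) e \<times> graded_hom scale (susp V) V e"

text \<open>Exponent of $\chi(\sigma;g_1,\dots,g_n)$, where $d_i=|g_i|$; positions are counted from 0.\<close>
definition chi_exp :: "(nat \<Rightarrow> nat) \<Rightarrow> int list \<Rightarrow> int" where
  "chi_exp \<sigma> ds = (if evenperm \<sigma> then 0 else 1) +
     (\<Sum>(i, j) \<in> {(i, j). i < j \<and> j < length ds \<and> \<sigma> j < \<sigma> i}. ds ! \<sigma> i * ds ! \<sigma> j)"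

text \<open>$l_{n+1}(sh\otimes g_1\otimes\cdots\otimes g_n)$; only the component of \<open>sh\<close> of arity \<open>n\<close> contributes.\<close>
definition l_front :: "'v::ab_group_add hmap \<Rightarrow> 'v hmap list \<Rightarrow> 'v fn" where
  "l_front sh gs = (\<lambda>xs. let n = length gs; sh\<^sub>n = (fst sh, arity_part n (snd sh)) in
     \<Sum>\<sigma> | \<sigma> permutes {..<n}.
       let g\<sigma> = map (\<lambda>i. gs ! \<sigma> i) [0..<n];
           \<eta> = chi_exp \<sigma> (map fst gs) + int n * fst sh + (\<Sum>k = 1..<n. \<Sum>g \<leftarrow> take k g\<sigma>. fst g)
       in ksgn \<eta> (\<Sum>k = 0..n.
            let \<xi> = fst sh * (\<Sum>g \<leftarrow> take k g\<sigma>. fst g + 1) + int k in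
            ksgn \<xi> (snd (s_inv_post
              (foldr (\<lambda>g h. brace (s_post g) [h]) (take k g\<sigma>)
                 (brace sh\<^sub>n (map s_post (drop k g\<sigma>))))) xs)))"

text \<open>$l_{n+1}(g_1\otimes\cdots\otimes g_k\otimes sh\otimes g_{k+1}\otimes\cdots\otimes g_n)$\<close>
definition l_mid :: "'v::ab_group_add hmap list \<Rightarrow> 'v hmap \<Rightarrow> 'v hmap list \<Rightarrow> 'v fn" where
  "l_mid gs sh gs' = (\<lambda>xs. ksgn (fst sh * (\<Sum>g \<leftarrow> gs. fst g) + int (length gs)) (l_front sh (gs @ gs') xs))"

text \<open>The operation \<open>l\<^sub>n\<close> on a list of \<open>n\<close> homogeneous elements of the direct sum, each given with its
  degree: the multilinear extension of the operations above, all other components being zero.\<close>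
definition l_op :: "(int \<times> 'v::ab_group_add cochain) list \<Rightarrow> int \<times> 'v cochain" where
  "l_op \<alpha>s = (let n = length \<alpha>s;
       alg = (\<lambda>i. (fst (\<alpha>s ! i), fst (snd (\<alpha>s ! i))));
       njo = map (\<lambda>(d, f, g). (d, g)) \<alpha>s
     in (sum_list (map fst \<alpha>s) + int n - 2,
         (\<lambda>xs. if n = 2 then snd (gerst (alg 0) (alg 1)) xs else 0),
         (\<lambda>xs. if 2 \<le> n then \<Sum>k<n. l_mid (take k njo) (alg k) (drop (Suc k) njo) xs else 0)))"

text \<open>The Maurer--Cartan series is an infinite sum in a product of Hom spaces; it is required to
  become stationary with value 0 on every word.\<close>
definition mc_partial :: "('k::field_char_0 \<Rightarrow> 'v::ab_group_add \<Rightarrow> 'v) \<Rightarrow> 'v cochain \<Rightarrow> nat \<Rightarrow> 'v cochain" where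
  "mc_partial scale \<alpha> N =
     (let L = (\<lambda>n. snd (l_op (replicate n (-1, \<alpha>))));
          term = (\<lambda>n y. scale (1 / fact n) (ksgn (int (n * (n - 1) div 2)) y))
      in (\<lambda>xs. \<Sum>n = 1..N. term n (fst (L n) xs), \<lambda>xs. \<Sum>n = 1..N. term n (snd (L n) xs)))"

definition maurer_cartan ::
  "('k::field_char_0 \<Rightarrow> 'v::ab_group_add \<Rightarrow> 'v) \<Rightarrow> (int \<Rightarrow> 'v set) \<Rightarrow> 'v cochain set" where
  "maurer_cartan scale V = {\<alpha> \<in> C_NjA scale V (-1). \<forall>xs \<in> words (susp V).
     \<forall>\<^sub>F N in sequentially. fst (mc_partial scale \<alpha> N) xs = 0 \<and> snd (mc_partial scale \<alpha> N) xs = 0}"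

definition bilinear_map :: "('k::field \<Rightarrow> 'v::ab_group_add \<Rightarrow> 'v) \<Rightarrow> ('v \<Rightarrow> 'v \<Rightarrow> 'v) \<Rightarrow> bool" where
  "bilinear_map scale m \<longleftrightarrow> (\<forall>x. Vector_Spaces.linear scale scale (m x)) \<and>
     (\<forall>y. Vector_Spaces.linear scale scale (\<lambda>x. m x y))"

definition nijenhuis_algebra ::
  "('k::field \<Rightarrow> 'v::ab_group_add \<Rightarrow> 'v) \<Rightarrow> ('v \<Rightarrow> 'v \<Rightarrow> 'v) \<Rightarrow> ('v \<Rightarrow> 'v) \<Rightarrow> bool" where
  "nijenhuis_algebra scale m P \<longleftrightarrow>
     bilinear_map scale m \<and> (\<forall>x y z. m (m x y) z = m x (m y z)) \<and>
     Vector_Spaces.linear scale scale P \<and>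
     (\<forall>x y. m (P x) (P y) = P (m (P x) y + m x (P y) - P (m x y)))"

text \<open>$m=s^{-1}\circ b_2\circ s^{\otimes 2}$ and $P=R_1\circ s$ on elements of degree 0.\<close>
definition structure_of :: "'v::ab_group_add cochain \<Rightarrow> ('v \<Rightarrow> 'v \<Rightarrow> 'v) \<times> ('v \<Rightarrow> 'v)" where
  "structure_of = (\<lambda>(b, R).
     (\<lambda>x y. snd (s_inv_post (compose (-1, arity_part 2 b) [(1, h_s), (1, h_s)])) [(0, x), (0, y)],
      \<lambda>x. snd (compose (-1, arity_part 1 R) [(1, h_s)]) [(0, x)]))"

end

theory Submission
  imports Defs
begin

text \<open>
  For \<open>V\<close> concentrated in degree 0, every letter of a word in \<open>sV\<close> that can contribute to a
  multilinear map has degree 1, so a word of length \<open>n\<close> has degree \<open>n\<close>. A map of degree \<open>-1\<close> into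
  \<open>sV\<close> therefore lives in arity 2 only, and one into \<open>V\<close> in arity 1 only. Hence a degree \<open>-1\<close>
  element of $\mathfrak{C}_{\mathrm{NjA}}(V)$ is the same as a pair of a bilinear map \<open>B\<close> and a linear
  map \<open>P\<close> (lemmas \<open>C_NjA_cases\<close> and \<open>cochains_in_C_NjA\<close>), which settles the first
  bijection; $s\otimes s$ contributes no sign on elements of degree 0.

  For such an element \<open>\<alpha> = (b, R)\<close> only two values of \<open>n\<close> contribute to the Maurer--Cartan
  series. In the first component it is \<open>n = 2\<close>: there $[b,b]_{\mathrm G}=2\,b\{b\}$, and
  \[ b\{b\}(sx, sy, sz) = B (B (x, y), z) - B (x, B (y, z)), \]
  where the minus sign is the Koszul sign of moving \<open>b\<close>, of degree \<open>-1\<close>, past \<open>sx\<close>, of degree 1. In the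
  second component, $l_{n+1}$ with one entry \<open>b\<close> and \<open>n\<close> entries \<open>R\<close> vanishes unless \<open>n\<close> is
  the arity of \<open>b\<close>, so \<open>n = 2\<close>, the term $l_3$. The map \<open>sR\<close> has degree 0 and creates no Koszul
  signs; thus $b\{sR,sR\}$, $sR\{b\{sR\}\}$ and $sR\{sR\{b\}\}$ send \<open>(sx, sy)\<close> to
  \[ B (P x, P y), \quad P (B (P x, y) + B (x, P y)), \quad P (P (B (x, y))), \]
  with $(-1)^\xi = (-1)^k$, so that their signed sum is the failure of the Nijenhuis identity
  (\<open>nijenhuis_defect\<close>). The remaining signs and multiplicities are constants: two permutations with
  equal sign, and three equal positions of \<open>b\<close> among the arguments. They add up to a factor 6,
  which cancels 1/3!, and the Maurer--Cartan element condition reads: the associator and the defect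
  vanish (lemmas \<open>mc_partial_eq\<close> and \<open>maurer_cartan_iff_nijenhuis\<close>).
\<close>

section \<open>Cochains of degree -1\<close>

text \<open>
  A list with a nonzero letter of degree other than 1 is not a word in \<open>sV\<close>, and \<open>graded_hom\<close> asks
  for the value 0 there; hence the tests on the degrees.
\<close>

definition bilinear_cochain :: "('v \<Rightarrow> 'v \<Rightarrow> 'v) \<Rightarrow> 'v::zero fn" where
  "bilinear_cochain B xs =
     (case xs of [(d, x), (e, y)] \<Rightarrow> if d = 1 \<and> e = 1 then B x y else 0 | _ \<Rightarrow> 0)"

definition linear_cochain :: "('v \<Rightarrow> 'v) \<Rightarrow> 'v::zero fn" where
  "linear_cochain P xs = (case xs of [(d, x)] \<Rightarrow> if d = 1 then P x else 0 | _ \<Rightarrow> 0)"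

lemma bilinear_cochain_simps [simp]:
  "bilinear_cochain B [(d, x), (e, y)] = (if d = 1 \<and> e = 1 then B x y else 0)"
  "length xs \<noteq> 2 \<Longrightarrow> bilinear_cochain B xs = 0"
  by (auto simp: bilinear_cochain_def split: list.splits)

lemma linear_cochain_simps [simp]:
  "linear_cochain P [(d, x)] = (if d = 1 then P x else 0)"
  "length xs \<noteq> 1 \<Longrightarrow> linear_cochain P xs = 0"
  by (auto simp: linear_cochain_def split: list.splits)

lemma arity_part_bilinear_cochain [simp]:
  "arity_part n (bilinear_cochain B) = (if n = 2 then bilinear_cochain B else (\<lambda>_. 0))"
  by (auto simp: arity_part_def fun_eq_iff)

lemma arity_part_linear_cochain [simp]:
  "arity_part n (linear_cochain P) = (if n = 1 then linear_cochain P else (\<lambda>_. 0))"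
  by (auto simp: arity_part_def fun_eq_iff)

lemma deg_simps [simp]: "deg [] = 0" "deg (x # xs) = fst x + deg xs"
  by (simp_all add: deg_def)

lemma ksgn_simps [simp]: "ksgn e 0 = 0" "even e \<Longrightarrow> ksgn e x = x" "odd e \<Longrightarrow> ksgn e x = - x"
  by (simp_all add: ksgn_def)

lemma length_2_cases:
  assumes "length xs = 2"
  obtains d x e y where "xs = [(d, x), (e, y)]"
  using assms by (auto simp: numeral_2_eq_2 length_Suc_conv)

lemma length_3_cases:
  assumes "length xs = 3"
  obtains d x e y f z where "xs = [(d, x), (e, y), (f, z)]"
  using assms by (auto simp: numeral_3_eq_3 length_Suc_conv)

section \<open>Braces of a bilinear and a linear cochain\<close>

lemma length_tensor_apply: "length (snd (tensor_apply \<phi>s xs)) = length \<phi>s"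
  by (induction \<phi>s xs rule: tensor_apply.induct) (auto simp: Let_def split: prod.splits)

lemma length_insertion:
  "length as = Suc (length gs) \<Longrightarrow> length (insertion as gs) = sum_list as + length gs"
  by (induction as gs rule: insertion.induct) (auto simp: length_Suc_conv)

text \<open>
  In a brace, \<open>sum_list as\<close> counts the identities and \<open>length gs\<close> the inserted maps, so only
  insertions with altogether \<open>n\<close> factors feed a map of arity \<open>n\<close>. For \<open>n \<le> 2\<close> this leaves
  few enough index lists to name them one by one.
\<close>

lemma brace_arity:
  assumes f: "arity_part n f = f"
  shows "snd (brace (d, f) gs) xs =
    (\<Sum>(as, ns) \<in> {(as, ns) \<in> insertions (length gs) (length xs). sum_list as + length gs = n}.
       snd (compose (d, f) (insertion as (zip ns gs))) xs)"
proof -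
  have zero: "snd (compose (d, f) (insertion as (zip ns gs))) xs = 0"
    if "(as, ns) \<in> insertions (length gs) (length xs)" "sum_list as + length gs \<noteq> n" for as ns
  proof -
    have len: "length (insertion as (zip ns gs)) \<noteq> n"
      using that by (subst length_insertion) (auto simp: insertions_def)
    have f0: "f ys = 0" if "length ys \<noteq> n" for ys
      using fun_cong[OF f, of ys] that by (simp add: arity_part_def)
    show ?thesis
      using length_tensor_apply[of "insertion as (zip ns gs)" xs] len
      by (auto simp: compose_def f0 split: prod.splits)
  qed
  show ?thesis
    unfolding brace_def snd_conv
    by (rule sum.mono_neutral_right) (auto simp: finite_insertions intro: zero)
qed

lemma brace_zero: "snd (brace (d, \<lambda>_. 0) gs) = (\<lambda>_. 0)"
  by (auto simp: brace_def compose_def fun_eq_iff intro!: sum.neutral split: prod.splits)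

lemma tensor_apply_identities:
  "tensor_apply (replicate (length xs) (1, h_id)) xs = (0, xs)"
  by (induction xs) (auto simp: h_id_def sum_list_replicate)

lemma brace_empty:
  fixes f :: "'v::ab_group_add hmap"
  shows "snd (brace f []) = snd f"
proof
  fix xs :: "'v word"
  have "insertions 0 (length xs) = {([length xs], [])}"
    by (auto simp: insertions_def length_Suc_conv)
  then show "snd (brace f []) xs = snd f xs"
    using tensor_apply_identities[of xs]
    by (simp add: brace_def compose_def sum_list_replicate)
qed

lemma brace_linear_cochain:
  "snd (brace (d, linear_cochain P) [g]) xs =
     (if xs = [] then 0 else linear_cochain P [(fst g + deg xs, snd g xs)])"
proof -
  have "{(as, ns) \<in> insertions 1 (length xs). sum_list as + 1 = 1} =
      (if xs = [] then {} else {([0, 0], [length xs])})"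
    by (auto simp: insertions_def length_Suc_conv Suc_le_eq)
  then show ?thesis
    by (simp add: brace_arity[where n = 1] compose_def)
qed

text \<open>
  One input of the bilinear map takes a single letter and \<open>g\<close> takes all the others; when \<open>g\<close>
  stands on the right, it has to move past the first letter.
\<close>

lemma brace_bilinear_cochain:
  "snd (brace (d, bilinear_cochain B) [g]) xs =
     (if length xs < 2 then 0 else
        bilinear_cochain B [(fst g + deg (butlast xs), snd g (butlast xs)), last xs] +
        ksgn (fst g * fst (hd xs)) (bilinear_cochain B [hd xs, (fst g + deg (tl xs), snd g (tl xs))]))"
proof (cases "length xs < 2")
  case True
  then have "snd (brace (d, bilinear_cochain B) [g]) xs = 0"
    by (subst brace_arity[where n = 2])
      (auto simp: insertions_def length_Suc_conv intro!: sum.neutral)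
  with True show ?thesis
    by simp
next
  case False
  then obtain x ys z where xs: "xs = x # ys @ [z]"
    by (cases xs; cases "tl xs" rule: rev_cases) auto
  have "{(as, ns) \<in> insertions 1 (length xs). sum_list as + 1 = 2} =
      {([0, 1], [length xs - 1]), ([1, 0], [length xs - 1])}"
    using False by (auto simp: insertions_def length_Suc_conv add_is_1)
  then show ?thesis
    by (cases x; cases z)
      (simp add: brace_arity[where n = 2] compose_def Let_def xs h_id_def butlast_append)
qed

text \<open>
  The two insertions give the two ways of bracketing; the Koszul sign of the second is
  $(-1)^{|b|\cdot 1}$, which turns their sum into the associator.
\<close>

lemma brace_bilinear_bilinear:
  fixes B :: "'v \<Rightarrow> 'v \<Rightarrow> 'v::ab_group_add"
  assumes B0: "\<And>x. B x 0 = 0" "\<And>x. B 0 x = 0"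
  shows "snd (brace (-1, bilinear_cochain B) [(-1, bilinear_cochain B)]) xs =
    (case xs of [(d, x), (e, y), (f, z)] \<Rightarrow>
       if d = 1 \<and> e = 1 \<and> f = 1 then B (B x y) z - B x (B y z) else 0 | _ \<Rightarrow> 0)"
proof (cases "length xs = 3")
  case True
  then show ?thesis
    by (rule length_3_cases) (auto simp: brace_bilinear_cochain B0)
next
  case False
  then have "length (butlast xs) \<noteq> 2" "length xs \<ge> 2 \<Longrightarrow> length (tl xs) \<noteq> 2"
    by auto
  with False show ?thesis
    by (cases "last xs"; cases "hd xs") (auto simp: brace_bilinear_cochain B0 split: list.splits)
qed

lemma brace_bilinear_linear:
  fixes B :: "'v \<Rightarrow> 'v \<Rightarrow> 'v::ab_group_add"
  assumes B0: "\<And>x. B x 0 = 0" "\<And>x. B 0 x = 0"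
  shows "snd (brace (d, bilinear_cochain B) [(0, linear_cochain P)]) =
    bilinear_cochain (\<lambda>x y. B (P x) y + B x (P y))"
proof
  fix xs :: "'v word"
  show "snd (brace (d, bilinear_cochain B) [(0, linear_cochain P)]) xs =
    bilinear_cochain (\<lambda>x y. B (P x) y + B x (P y)) xs"
  proof (cases "length xs = 2")
    case True
    then show ?thesis
      by (rule length_2_cases) (auto simp: brace_bilinear_cochain B0)
  next
    case False
    then have "length xs \<ge> 2 \<Longrightarrow> length (butlast xs) \<noteq> 1" "length xs \<ge> 2 \<Longrightarrow> length (tl xs) \<noteq> 1"
      by auto
    with False show ?thesis
      by (cases "last xs"; cases "hd xs") (auto simp: brace_bilinear_cochain B0)
  qed
qed

lemma brace_bilinear_linear_linear:
  fixes B :: "'v \<Rightarrow> 'v \<Rightarrow> 'v::ab_group_add"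
  assumes B0: "\<And>x. B x 0 = 0" "\<And>x. B 0 x = 0"
  shows "snd (brace (d, bilinear_cochain B) [(0, linear_cochain P), (0, linear_cochain P)]) =
    bilinear_cochain (\<lambda>x y. B (P x) (P y))"
proof
  fix xs :: "'v word"
  let ?I = "{(as, ns) \<in> insertions 2 (length xs). sum_list as + 2 = 2}"
  let ?g = "(0, linear_cochain P)"
  have I: "(as, ns) \<in> ?I \<longleftrightarrow>
      (\<exists>i j. as = [0, 0, 0] \<and> ns = [i, j] \<and> 1 \<le> i \<and> 1 \<le> j \<and> i + j = length xs)" for as ns
    by (auto simp: insertions_def length_Suc_conv numeral_2_eq_2 numeral_3_eq_3)
  \<comment> \<open>No identities remain, so an insertion is a cut of the word into two nonempty parts.\<close>
  have I_image: "?I = (\<lambda>i. ([0, 0, 0], [i, length xs - i])) ` {1..<length xs}"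
    unfolding set_eq_iff split_paired_All I image_iff Bex_def by auto
  have inj: "inj_on (\<lambda>i. ([0, 0, 0], [i, length xs - i])) {1..<length xs}"
    by (auto simp: inj_on_def)
  have "snd (brace (d, bilinear_cochain B) [?g, ?g]) xs =
      (\<Sum>(as, ns) \<in> ?I. snd (compose (d, bilinear_cochain B) (insertion as (zip ns [?g, ?g]))) xs)"
    by (subst brace_arity[where n = 2]) (simp_all add: numeral_2_eq_2)
  also have "\<dots> = (\<Sum>i = 1..<length xs. bilinear_cochain B
      [(deg (take i xs), linear_cochain P (take i xs)), (deg (drop i xs), linear_cochain P (drop i xs))])"
    unfolding I_image sum.reindex[OF inj]
    by (intro sum.cong refl) (simp add: compose_def Let_def)
  also have "\<dots> = bilinear_cochain (\<lambda>x y. B (P x) (P y)) xs"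
  proof (cases "length xs = 2")
    case True
    then show ?thesis
      by (rule length_2_cases) (auto simp: B0)
  next
    case False
    have "bilinear_cochain B [(deg (take i xs), linear_cochain P (take i xs)),
        (deg (drop i xs), linear_cochain P (drop i xs))] = 0" if "i \<in> {1..<length xs}" for i
    proof -
      have "length (take i xs) \<noteq> 1 \<or> length (drop i xs) \<noteq> 1"
        using that False by auto
      then have "linear_cochain P (take i xs) = 0 \<or> linear_cochain P (drop i xs) = 0"
        using linear_cochain_simps(2) by blast
      then show ?thesis
        by (auto simp: B0)
    qed
    with False show ?thesis
      by (simp add: sum.neutral)
  qed
  finally show "snd (brace (d, bilinear_cochain B) [?g, ?g]) xs =
      bilinear_cochain (\<lambda>x y. B (P x) (P y)) xs" .
qed

text \<open>
  The degree of the inner map matters: its value on a word of degree 2 has to be a letter of degree 1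
  for the outer map to see it.
\<close>

lemma brace_linear_bilinear:
  fixes P :: "'v \<Rightarrow> 'v::ab_group_add"
  assumes "P 0 = 0"
  shows "snd (brace (d, linear_cochain P) [(-1, bilinear_cochain C)]) =
    bilinear_cochain (\<lambda>x y. P (C x y))"
proof
  fix xs :: "'v word"
  show "snd (brace (d, linear_cochain P) [(-1, bilinear_cochain C)]) xs =
    bilinear_cochain (\<lambda>x y. P (C x y)) xs"
  proof (cases "length xs = 2")
    case True
    then show ?thesis
      by (rule length_2_cases) (auto simp: brace_linear_cochain assms)
  qed (auto simp: brace_linear_cochain assms)
qed


section \<open>The operations evaluated on equal arguments\<close>

lemma iterated_brace_zero:
  assumes "P 0 = 0" "snd h = (\<lambda>_. 0)"
  shows "snd (((\<lambda>h. brace (s_post (-1, linear_cochain P)) [h]) ^^ k) h) xs = 0"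
proof (induction k arbitrary: xs)
  case (Suc k)
  then show ?case
    using assms(1) by (simp add: s_post_def brace_linear_cochain)
qed (simp add: assms(2))

lemma map_permuted_replicate:
  assumes "\<sigma> permutes {..<n}"
  shows "map (\<lambda>i. replicate n g ! \<sigma> i) [0..<n] = replicate n g"
  using permutes_in_image[OF assms] by (intro nth_equalityI) (simp_all add: lessThan_iff)

text \<open>
  The operation $l_{n+1}$ sees only the arity \<open>n\<close> component of its \<open>sh\<close> argument, which is 0 for
  \<open>n \<noteq> 2\<close>; this makes the Maurer--Cartan series finite.
\<close>

lemma l_front_other_arity:
  assumes "P 0 = 0" "n \<noteq> 2"
  shows "l_front (d, bilinear_cochain B) (replicate n (-1, linear_cochain P)) = (\<lambda>_. 0)"
proof
  fix xs
  have zero: "snd (((\<lambda>h. brace (s_post (-1, linear_cochain P)) [h]) ^^ k) (brace (d, \<lambda>_. 0) gs)) xs = 0"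
    for k gs
    using iterated_brace_zero[where P = P and h = "brace (d, \<lambda>_. 0) gs" and k = k and xs = xs]
    by (simp only: assms(1) brace_zero simp_thms)
  show "l_front (d, bilinear_cochain B) (replicate n (-1, linear_cochain P)) xs = 0"
    using assms(2)
    by (auto simp: l_front_def Let_def map_permuted_replicate s_inv_post_def zero intro!: sum.neutral)
qed

text \<open>
  For linear \<open>P\<close>, the difference of the two sides of the Nijenhuis identity, with the last term \<open>P (P (B x y))\<close> kept
  apart, as it comes from a brace of its own.
\<close>

definition nijenhuis_defect :: "('v \<Rightarrow> 'v \<Rightarrow> 'v) \<Rightarrow> ('v \<Rightarrow> 'v) \<Rightarrow> 'v \<Rightarrow> 'v \<Rightarrow> 'v::ab_group_add" where
  "nijenhuis_defect B P x y = B (P x) (P y) - P (B (P x) y + B x (P y)) + P (P (B x y))"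

lemma fst_brace: "fst (brace f gs) = fst f + sum_list (map fst gs)"
  by (simp add: brace_def)

text \<open>
  The degrees are $|b| = |R| = -1$ and \<open>|sR| = 0\<close>. Hence $\xi \equiv k$, and $\eta$ is odd for
  both permutations: the transposition has sign \<open>-1\<close> and, for two elements of odd degree, Koszul
  sign \<open>-1\<close>, so $\chi = 1$ throughout, and the remaining exponent is $2\cdot(-1) + (-1) = -3$.
\<close>

lemma l_front_arity_2:
  assumes B0: "\<And>x. B x 0 = 0" "\<And>x. B 0 x = 0" and P0: "P 0 = 0"
  shows "l_front (-1, bilinear_cochain B) (replicate 2 (-1, linear_cochain P)) xs =
    - (bilinear_cochain (nijenhuis_defect B P) xs + bilinear_cochain (nijenhuis_defect B P) xs)"
proof -
  let ?b = "(-1, bilinear_cochain B)" and ?g = "(-1, linear_cochain P)"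
  let ?t = "\<lambda>k. foldr (\<lambda>g h. brace (s_post g) [h]) (replicate k ?g)
    (brace ?b (map s_post (replicate (2 - k) ?g)))"
  have b1: "brace ?b [(0, linear_cochain P)] = (-1, bilinear_cochain (\<lambda>x y. B (P x) y + B x (P y)))"
    by (rule prod_eqI) (simp_all add: fst_brace brace_bilinear_linear B0)
  have b0: "brace ?b [] = ?b"
    by (rule prod_eqI) (simp_all add: fst_brace brace_empty)
  have P1: "brace (0, linear_cochain P) [(-1, bilinear_cochain C)] =
      (-1, bilinear_cochain (\<lambda>x y. P (C x y)))" for C
    by (rule prod_eqI) (simp_all add: fst_brace brace_linear_bilinear P0)
  have t0: "snd (?t 0) = bilinear_cochain (\<lambda>x y. B (P x) (P y))"
    by (simp add: s_post_def brace_bilinear_linear_linear B0 numeral_2_eq_2)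
  have t1: "snd (?t 1) = bilinear_cochain (\<lambda>x y. P (B (P x) y + B x (P y)))"
    by (simp add: s_post_def b1 P1)
  have t2: "snd (?t 2) = bilinear_cochain (\<lambda>x y. P (P (B x y)))"
    by (simp add: s_post_def b0 P1 numeral_2_eq_2)
  have "bilinear_cochain (\<lambda>x y. B (P x) (P y)) xs +
      (bilinear_cochain (\<lambda>x y. P (P (B x y))) xs -
       bilinear_cochain (\<lambda>x y. P (B (P x) y + B x (P y))) xs) =
      bilinear_cochain (nijenhuis_defect B P) xs"
    by (auto simp: bilinear_cochain_def nijenhuis_defect_def split: list.splits)
  then have "snd (?t 0) xs + (snd (?t 2) xs - snd (?t 1) xs) = bilinear_cochain (nijenhuis_defect B P) xs"
    unfolding t0 t1 t2 .
  moreover have "{0..2} = {0, 1, 2::nat}"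
    by auto
  ultimately have inner: "(\<Sum>k = 0..2. ksgn (-1 * (\<Sum>g \<leftarrow> take k (replicate 2 ?g). fst g + 1) + int k)
      (snd (s_inv_post (foldr (\<lambda>g h. brace (s_post g) [h]) (take k (replicate 2 ?g))
        (brace ?b (map s_post (drop k (replicate 2 ?g)))))) xs)) =
      bilinear_cochain (nijenhuis_defect B P) xs"
    by (simp add: s_inv_post_def sum_list_replicate)
  have two: "{..<2::nat} = {0, 1}"
    by auto
  have perms: "{\<sigma>. \<sigma> permutes {..<2::nat}} = {id, transpose 0 1}"
    unfolding two permutes_doubleton_iff by auto
  have distinct: "id \<noteq> transpose 0 (1::nat)"
    by (auto simp: fun_eq_iff transpose_def intro!: exI[of _ "0::nat"])
  have "{(i, j). i < j \<and> j < 2 \<and> transpose 0 1 j < transpose 0 1 i} = {(0, 1::nat)}"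
    by (auto simp: transpose_def less_2_cases_iff)
  then have chi_swap: "chi_exp (transpose 0 1) (replicate 2 (-1)) = 2"
    by (simp add: chi_exp_def evenperm_swap)
  have chi_id: "chi_exp id (replicate 2 (-1)) = 0"
    by (auto simp: chi_exp_def intro!: sum.neutral)
  have "l_front ?b (replicate 2 ?g) xs = (\<Sum>\<sigma> | \<sigma> permutes {..<2}.
      ksgn (chi_exp \<sigma> (replicate 2 (-1)) - 3) (bilinear_cochain (nijenhuis_defect B P) xs))"
    unfolding l_front_def Let_def length_replicate fst_conv snd_conv arity_part_bilinear_cochain
    by (rule sum.cong[OF refl])
      (simp only: mem_Collect_eq map_permuted_replicate inner refl if_True,
        simp add: sum_list_replicate numeral_2_eq_2)
  also have "\<dots> = - (bilinear_cochain (nijenhuis_defect B P) xs + bilinear_cochain (nijenhuis_defect B P) xs)"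
    unfolding perms using distinct by (simp add: chi_swap[simplified] chi_id[simplified])
  finally show ?thesis .
qed


text \<open>
  Moving \<open>b\<close> past \<open>k\<close> copies of \<open>R\<close> costs $(-1)^{k}$ from the degrees and $(-1)^{k}$ from skew
  symmetry, so the position of \<open>b\<close> is irrelevant.
\<close>

lemma l_mid_replicate:
  "l_mid (replicate k (-1, R)) (-1, b) (replicate m (-1, R)) xs =
    l_front (-1, b) (replicate (k + m) (-1, R)) xs"
  by (simp add: l_mid_def sum_list_replicate replicate_add)

section \<open>Degree -1 elements are pairs of a bilinear and a linear map\<close>

lemma words_susp_concentrated0:
  "xs \<in> words (susp concentrated0) \<longleftrightarrow> xs \<noteq> [] \<and> (\<forall>(d, x) \<in> set xs. d = 1 \<or> x = 0)"
  by (auto simp: words_def susp_def concentrated0_def split: if_splits)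

lemma deg_all_one: "\<forall>x \<in> set xs. fst x = 1 \<Longrightarrow> deg xs = int (length xs)"
  by (induction xs) auto

context vector_space
begin

lemma bilinear_map_iff:
  "bilinear_map scale B \<longleftrightarrow>
    (\<forall>x y z. B (x + y) z = B x z + B y z) \<and> (\<forall>x y z. B x (y + z) = B x y + B x z) \<and>
    (\<forall>c x y. B (scale c x) y = scale c (B x y)) \<and> (\<forall>c x y. B x (scale c y) = scale c (B x y))"
  unfolding bilinear_map_def Vector_Spaces.linear_iff by (auto simp: vector_space_axioms)

lemma bilinear_map_zero:
  assumes "bilinear_map scale B"
  shows "B x 0 = 0" "B 0 x = 0"
proof -
  have "B x (scale 0 0) = scale 0 (B x 0)" "B (scale 0 0) x = scale 0 (B 0 x)"
    using assms unfolding bilinear_map_iff by blast+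
  then show "B x 0 = 0" "B 0 x = 0"
    by simp_all
qed

text \<open>
  A letter of degree other than 1 in a word is 0, and multilinear maps vanish on words containing 0.
\<close>

lemma graded_hom_vanishes:
  assumes f: "f \<in> graded_hom scale (susp concentrated0) W e" and x: "x \<in> set xs" "fst x \<noteq> 1"
  shows "f xs = 0"
proof (cases "xs \<in> words (susp concentrated0)")
  case True
  obtain us vs where xs: "xs = us @ x # vs"
    using x(1) by (meson split_list)
  with True x(2) obtain d where x0: "x = (d, 0)"
    by (cases x) (auto simp: words_susp_concentrated0)
  have "f (us @ (d, scale 0 0) # vs) = scale 0 (f (us @ (d, 0) # vs))"
    using f True unfolding graded_hom_def xs x0 by blast
  then show ?thesis
    by (simp add: xs x0)
qed (use f in \<open>auto simp: graded_hom_def\<close>)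

text \<open>
  A word of length \<open>n\<close> in letters of degree 1 has degree \<open>n\<close>, so its image has degree \<open>n - 1\<close>; and
  \<open>sV\<close> is nonzero in degree 1 only. Hence only \<open>n = 2\<close> survives.
\<close>

lemma graded_hom_susp_susp:
  assumes f: "f \<in> graded_hom scale (susp concentrated0) (susp concentrated0) (-1)"
  defines "B \<equiv> \<lambda>x y. f [(1, x), (1, y)]"
  shows "f = bilinear_cochain B" "bilinear_map scale B"
proof -
  have nonhom: "f xs = 0" if "\<not> (\<forall>x \<in> set xs. fst x = 1)" for xs
    using graded_hom_vanishes[OF f] that by blast
  show "f = bilinear_cochain B"
  proof
    fix xs
    show "f xs = bilinear_cochain B xs"
    proof (cases "length xs = 2")
      case True
      then show ?thesis
        by (rule length_2_cases) (auto simp: B_def intro: nonhom)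
    next
      case False
      have "f xs = 0" if "xs \<in> words (susp concentrated0)" "\<forall>x \<in> set xs. fst x = 1"
      proof -
        have "f xs \<in> susp concentrated0 (int (length xs) - 1)"
          using f that(1) deg_all_one[OF that(2)] by (auto simp: graded_hom_def)
        with False show ?thesis
          by (auto simp: susp_def concentrated0_def split: if_splits)
      qed
      with f False nonhom[of xs] show ?thesis
        by (auto simp: graded_hom_def)
    qed
  qed
  have word: "[(1, x), (1, y)] \<in> words (susp concentrated0)" for x y :: 'b
    by (auto simp: words_susp_concentrated0)
  have add: "f (us @ (1, x + y) # vs) = f (us @ (1, x) # vs) + f (us @ (1, y) # vs)"
      if "us @ (1, x) # vs \<in> words (susp concentrated0)" "us @ (1, y) # vs \<in> words (susp concentrated0)"
      for us x y vs
    using f that by (auto simp: graded_hom_def)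
  have scl: "f (us @ (1, scale c x) # vs) = scale c (f (us @ (1, x) # vs))"
      if "us @ (1, x) # vs \<in> words (susp concentrated0)" for us c x vs
    using f that by (auto simp: graded_hom_def)
  show "bilinear_map scale B"
    unfolding bilinear_map_iff B_def
    using add[where us = "[]" and vs = "[(1, z)]" for z, simplified, OF word word]
      add[where us = "[(1, z)]" and vs = "[]" for z, simplified, OF word word]
      scl[where us = "[]" and vs = "[(1, z)]" for z, simplified, OF word]
      scl[where us = "[(1, z)]" and vs = "[]" for z, simplified, OF word]
    by blast
qed

text \<open>With target \<open>V\<close>, nonzero in degree 0 only, the same count of degrees forces \<open>n = 1\<close>.\<close>

lemma graded_hom_susp:
  assumes f: "f \<in> graded_hom scale (susp concentrated0) concentrated0 (-1)"
  defines "P \<equiv> \<lambda>x. f [(1, x)]"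
  shows "f = linear_cochain P" "Vector_Spaces.linear scale scale P"
proof -
  have nonhom: "f xs = 0" if "\<not> (\<forall>x \<in> set xs. fst x = 1)" for xs
    using graded_hom_vanishes[OF f] that by blast
  show "f = linear_cochain P"
  proof
    fix xs
    show "f xs = linear_cochain P xs"
    proof (cases "length xs = 1")
      case True
      then obtain d x where "xs = [(d, x)]"
        by (auto simp: length_Suc_conv)
      then show ?thesis
        by (auto simp: P_def intro: nonhom)
    next
      case False
      have "f xs = 0" if "xs \<in> words (susp concentrated0)" "\<forall>x \<in> set xs. fst x = 1"
      proof -
        have "f xs \<in> concentrated0 (int (length xs) - 1)"
          using f that(1) deg_all_one[OF that(2)] by (auto simp: graded_hom_def)
        with False show ?thesis
          by (auto simp: concentrated0_def split: if_splits)
      qed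
      with f False nonhom[of xs] show ?thesis
        by (auto simp: graded_hom_def)
    qed
  qed
  have word: "[] @ (1, x) # [] \<in> words (susp concentrated0)" for x :: 'b
    by (auto simp: words_susp_concentrated0)
  have "P (x + y) = P x + P y" for x y
  proof -
    have "f ([] @ (1, x + y) # []) = f ([] @ (1, x) # []) + f ([] @ (1, y) # [])"
      using f word unfolding graded_hom_def by blast
    then show ?thesis
      by (simp add: P_def)
  qed
  moreover have "P (scale c x) = scale c (P x)" for c x
  proof -
    have "f ([] @ (1, scale c x) # []) = scale c (f ([] @ (1, x) # []))"
      using f word unfolding graded_hom_def by blast
    then show ?thesis
      by (simp add: P_def)
  qed
  ultimately show "Vector_Spaces.linear scale scale P"
    unfolding Vector_Spaces.linear_iff by (simp add: vector_space_axioms)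
qed

lemma bilinear_cochain_in_graded_hom:
  assumes B: "bilinear_map scale B"
  shows "bilinear_cochain B \<in> graded_hom scale (susp concentrated0) (susp concentrated0) (-1)"
proof -
  \<comment> \<open>The two slots of a word of length 2 where a letter can vary.\<close>
  have context_cases: "P" if "\<And>e z. us = [] \<Longrightarrow> vs = [(e, z)] \<Longrightarrow> P" "\<And>e z. us = [(e, z)] \<Longrightarrow> vs = [] \<Longrightarrow> P"
      "length us + length vs \<noteq> 1 \<Longrightarrow> P" for us vs :: "'b word" and P
    using that by (cases us; cases vs) auto
  have "bilinear_cochain B xs = 0" if "xs \<notin> words (susp concentrated0)" for xs
  proof (cases "length xs = 2")
    case True
    then show ?thesis
      by (rule length_2_cases) (use that in \<open>auto simp: words_susp_concentrated0\<close>)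
  qed simp
  moreover have "bilinear_cochain B xs \<in> susp concentrated0 (deg xs + -1)" for xs
  proof (cases "length xs = 2")
    case True
    then show ?thesis
      by (rule length_2_cases) (auto simp: susp_def concentrated0_def)
  qed (simp add: susp_def concentrated0_def)
  moreover have "bilinear_cochain B (us @ (d, x + y) # vs) =
      bilinear_cochain B (us @ (d, x) # vs) + bilinear_cochain B (us @ (d, y) # vs)" for us d x y vs
    using B by (rule_tac context_cases[of us vs]) (auto simp: bilinear_map_iff)
  moreover have "bilinear_cochain B (us @ (d, scale c x) # vs) =
      scale c (bilinear_cochain B (us @ (d, x) # vs))" for us d c x vs
    using B by (rule_tac context_cases[of us vs]) (auto simp: bilinear_map_iff)
  ultimately show ?thesis
    unfolding graded_hom_def by blast
qed

lemma linear_cochain_in_graded_hom: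
  assumes "Vector_Spaces.linear scale scale P"
  shows "linear_cochain P \<in> graded_hom scale (susp concentrated0) concentrated0 (-1)"
proof -
  have P: "P (x + y) = P x + P y" "P (scale c x) = scale c (P x)" for x y c
    using assms by (auto simp: Vector_Spaces.linear_iff)
  have codomain: "linear_cochain P xs \<in> concentrated0 (deg xs + -1)"
      and word: "xs \<notin> words (susp concentrated0) \<Longrightarrow> linear_cochain P xs = 0" for xs
    by (auto simp: linear_cochain_def concentrated0_def words_susp_concentrated0 split: list.splits)
  have "linear_cochain P (us @ (d, x + y) # vs) =
      linear_cochain P (us @ (d, x) # vs) + linear_cochain P (us @ (d, y) # vs)" for us d x y vs
    by (cases "us = [] \<and> vs = []") (auto simp: P)
  moreover have "linear_cochain P (us @ (d, scale c x) # vs) =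
      scale c (linear_cochain P (us @ (d, x) # vs))" for us d c x vs
    by (cases "us = [] \<and> vs = []") (auto simp: P)
  ultimately show ?thesis
    unfolding graded_hom_def using codomain word by blast
qed

end

lemma structure_of_cochains: "structure_of (bilinear_cochain B, linear_cochain P) = (B, P)"
  by (simp add: structure_of_def s_inv_post_def compose_def h_s_def Let_def)

section \<open>The Maurer--Cartan equation\<close>

text \<open>Since \<open>b\<close> is odd, $[b,b]_{\mathrm G}$ does not cancel but doubles.\<close>

lemma l_op_replicate_alg:
  "fst (snd (l_op (replicate n (-1, (b, R))))) xs =
    (if n = 2 then snd (brace (-1, b) [(-1, b)]) xs + snd (brace (-1, b) [(-1, b)]) xs else 0)"
  by (auto simp: l_op_def Let_def gerst_def ksgn_def)

lemma l_op_replicate_njo: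
  "snd (snd (l_op (replicate n (-1, (b, R))))) xs =
    (if 2 \<le> n then \<Sum>k<n. l_front (-1, b) (replicate (n - 1) (-1, R)) xs else 0)"
  by (auto simp: l_op_def Let_def l_mid_replicate min_def intro!: sum.cong)

context
  fixes scale :: "'k::field_char_0 \<Rightarrow> 'v::ab_group_add \<Rightarrow> 'v"
  assumes vs: "vector_space scale"
begin

interpretation vector_space scale by (fact vs)

text \<open>
  The coefficients 1/2! and 1/3! cancel the multiplicities: 2 from the bracket \<open>[b,b]\<close>, and 6 from
  three positions of \<open>b\<close> times two permutations of the copies of \<open>R\<close>. The signs are
  $(-1)^{1}$ for \<open>n = 2\<close>, and $(-1)^{3}$ for \<open>n = 3\<close>, the latter against the sign in
  \<open>l_front_arity_2\<close>.
\<close>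

lemma mc_partial_eq:
  assumes B: "bilinear_map scale B" and P: "P 0 = 0" and N: "N \<ge> 3"
  shows "fst (mc_partial scale (bilinear_cochain B, linear_cochain P) N) xs =
      - snd (brace (-1, bilinear_cochain B) [(-1, bilinear_cochain B)]) xs"
    and "snd (mc_partial scale (bilinear_cochain B, linear_cochain P) N) xs =
      bilinear_cochain (nijenhuis_defect B P) xs"
proof -
  let ?L = "\<lambda>n. snd (l_op (replicate n (-1, (bilinear_cochain B, linear_cochain P))))"
  let ?T = "snd (brace (-1, bilinear_cochain B) [(-1, bilinear_cochain B)]) xs"
  let ?D = "bilinear_cochain (nijenhuis_defect B P) xs"
  have single: "(\<Sum>n = 1..N. t n) = t m" if "\<And>n. n \<noteq> m \<Longrightarrow> t n = 0" "1 \<le> m" "m \<le> N"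
    for t :: "nat \<Rightarrow> 'v" and m
    using that by (subst sum.mono_neutral_right[of _ "{m}"]) auto
  have half: "scale (1 / 2) (x + x) = x" for x
    unfolding scale_right_distrib scale_left_distrib[symmetric] by simp
  have "fst (mc_partial scale (bilinear_cochain B, linear_cochain P) N) xs =
      scale (1 / fact 2) (ksgn (int (2 * (2 - 1) div 2)) (fst (?L 2) xs))"
    unfolding mc_partial_def Let_def fst_conv
    by (rule single) (use N in \<open>auto simp: l_op_replicate_alg\<close>)
  also have "\<dots> = - ?T"
    using half[of "- ?T"] by (simp add: l_op_replicate_alg)
  finally show "fst (mc_partial scale (bilinear_cochain B, linear_cochain P) N) xs = - ?T" .
  have L3: "snd (?L 3) xs = - (?D + ?D + ?D + ?D + ?D + ?D)"
  proof -
    have "snd (?L 3) xs =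
        (\<Sum>k < 3::nat. l_front (-1, bilinear_cochain B) (replicate 2 (-1, linear_cochain P)) xs)"
      by (simp add: l_op_replicate_njo)
    also have "\<dots> = (\<Sum>k \<in> {0, 1, 2::nat}. - (?D + ?D))"
      using l_front_arity_2[where B = B and P = P and xs = xs, OF bilinear_map_zero[OF B] P]
      by (intro sum.cong) auto
    finally show ?thesis
      by (simp add: algebra_simps)
  qed
  have "snd (mc_partial scale (bilinear_cochain B, linear_cochain P) N) xs =
      scale (1 / fact 3) (ksgn (int (3 * (3 - 1) div 2)) (snd (?L 3) xs))"
    unfolding mc_partial_def Let_def snd_conv
    by (rule single)
      (use N in \<open>auto simp: l_op_replicate_njo l_front_other_arity[where P = P, OF P]\<close>)
  also have "\<dots> = scale (1 / 6) (?D + ?D + ?D + ?D + ?D + ?D)"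
    using L3 by (simp add: fact_numeral ksgn_def)
  also have "\<dots> = ?D"
    unfolding scale_right_distrib scale_left_distrib[symmetric] by simp
  finally show "snd (mc_partial scale (bilinear_cochain B, linear_cochain P) N) xs = ?D" .
qed

lemma cochains_in_C_NjA:
  assumes "bilinear_map scale B" "Vector_Spaces.linear scale scale P"
  shows "(bilinear_cochain B, linear_cochain P) \<in> C_NjA scale concentrated0 (-1)"
  using bilinear_cochain_in_graded_hom[OF assms(1)] linear_cochain_in_graded_hom[OF assms(2)]
  by (simp add: C_NjA_def)

lemma C_NjA_cases:
  assumes "\<alpha> \<in> C_NjA scale concentrated0 (-1)"
  obtains B P where "\<alpha> = (bilinear_cochain B, linear_cochain P)"
    "bilinear_map scale B" "Vector_Spaces.linear scale scale P"
proof -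
  obtain b R where \<alpha>: "\<alpha> = (b, R)" "b \<in> graded_hom scale (susp concentrated0) (susp concentrated0) (-1)"
      "R \<in> graded_hom scale (susp concentrated0) concentrated0 (-1)"
    using assms by (auto simp: C_NjA_def)
  show thesis
    using that graded_hom_susp_susp[OF \<alpha>(2)] graded_hom_susp[OF \<alpha>(3)] \<alpha>(1) by blast
qed

text \<open>
  From \<open>N = 3\<close> on the partial sums are constant, so vanishing eventually is vanishing of this
  constant; on words it need be tested only on letters of degree 1.
\<close>

lemma maurer_cartan_iff_nijenhuis:
  assumes B: "bilinear_map scale B" and P: "Vector_Spaces.linear scale scale P"
  shows "(bilinear_cochain B, linear_cochain P) \<in> maurer_cartan scale concentrated0 \<longleftrightarrow>
    nijenhuis_algebra scale B P"
proof -
  note B0 = bilinear_map_zero[OF B]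
  have Padd: "P (x + y) = P x + P y" for x y
    using P by (simp add: Vector_Spaces.linear_iff)
  from Padd[of 0 0] have P0: "P 0 = 0"
    by simp
  let ?T = "snd (brace (-1, bilinear_cochain B) [(-1, bilinear_cochain B)])"
  let ?D = "bilinear_cochain (nijenhuis_defect B P)"
  let ?W = "words (susp concentrated0) :: 'v word set"
  have "(\<forall>\<^sub>F N in sequentially. fst (mc_partial scale (bilinear_cochain B, linear_cochain P) N) xs = 0 \<and>
      snd (mc_partial scale (bilinear_cochain B, linear_cochain P) N) xs = 0) \<longleftrightarrow> ?T xs = 0 \<and> ?D xs = 0" for xs
  proof -
    have "(\<forall>\<^sub>F N in sequentially. fst (mc_partial scale (bilinear_cochain B, linear_cochain P) N) xs = 0 \<and>
      snd (mc_partial scale (bilinear_cochain B, linear_cochain P) N) xs = 0) \<longleftrightarrow>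
      (\<forall>\<^sub>F N in sequentially. ?T xs = 0 \<and> ?D xs = 0)"
      by (rule eventually_cong[OF eventually_ge_at_top[of 3]])
        (simp add: mc_partial_eq[where P = P, OF B P0])
    then show ?thesis
      by simp
  qed
  then have "(bilinear_cochain B, linear_cochain P) \<in> maurer_cartan scale concentrated0 \<longleftrightarrow>
      (\<forall>xs \<in> ?W. ?T xs = 0) \<and> (\<forall>xs \<in> ?W. ?D xs = 0)"
    using cochains_in_C_NjA[OF B P] by (auto simp: maurer_cartan_def)
  also have "(\<forall>xs \<in> ?W. ?T xs = 0) \<longleftrightarrow> (\<forall>x y z. B (B x y) z = B x (B y z))"
  proof
    assume T: "\<forall>xs \<in> ?W. ?T xs = 0"
    have "?T [(1, x), (1, y), (1, z)] = 0" for x y z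
      using T by (simp add: words_susp_concentrated0)
    then show "\<forall>x y z. B (B x y) z = B x (B y z)"
      unfolding brace_bilinear_bilinear[where B = B, OF B0] by simp
  qed (auto simp: brace_bilinear_bilinear[where B = B, OF B0] split: list.splits)
  also have "(\<forall>xs \<in> ?W. ?D xs = 0) \<longleftrightarrow> (\<forall>x y. nijenhuis_defect B P x y = 0)"
  proof
    assume D: "\<forall>xs \<in> ?W. ?D xs = 0"
    have "?D [(1, x), (1, y)] = 0" for x y
      using D by (simp add: words_susp_concentrated0 del: bilinear_cochain_simps)
    then show "\<forall>x y. nijenhuis_defect B P x y = 0"
      by simp
  qed (auto simp: bilinear_cochain_def split: list.splits)
  also have "(\<forall>x y. nijenhuis_defect B P x y = 0) \<longleftrightarrow>
      (\<forall>x y. B (P x) (P y) = P (B (P x) y + B x (P y) - P (B x y)))"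
  proof -
    have Pdiff: "P (x - y) = P x - P y" for x y
      using Padd[of "x - y" y] by simp
    show ?thesis
      unfolding nijenhuis_defect_def Pdiff by (simp add: algebra_simps)
  qed
  finally show ?thesis
    using B P by (simp add: nijenhuis_algebra_def)
qed

end

theorem proposition5p4:
  fixes scale :: "'k::field_char_0 \<Rightarrow> 'v::ab_group_add \<Rightarrow> 'v"
  assumes "vector_space scale"
  shows "bij_betw structure_of (C_NjA scale concentrated0 (-1))
           {(m, P). bilinear_map scale m \<and> Vector_Spaces.linear scale scale P} \<and>
         bij_betw structure_of (maurer_cartan scale concentrated0)
           {(m, P). nijenhuis_algebra scale m P}"
proof
  let ?C = "C_NjA scale concentrated0 (-1)"
  let ?M = "{(m, P). bilinear_map scale m \<and> Vector_Spaces.linear scale scale P}"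
  let ?inv = "\<lambda>(m, P). (bilinear_cochain m, linear_cochain P)"
  show bij: "bij_betw structure_of ?C ?M"
  proof (rule bij_betw_byWitness[where f' = ?inv])
    show "\<forall>\<alpha> \<in> ?C. ?inv (structure_of \<alpha>) = \<alpha>" and "structure_of ` ?C \<subseteq> ?M"
      by (auto elim!: C_NjA_cases[OF assms] simp: structure_of_cochains)
    show "\<forall>mP \<in> ?M. structure_of (?inv mP) = mP"
      by (auto simp: structure_of_cochains)
    show "?inv ` ?M \<subseteq> ?C"
      using cochains_in_C_NjA[OF assms] by auto
  qed
  have sub: "maurer_cartan scale concentrated0 \<subseteq> ?C"
    by (auto simp: maurer_cartan_def)
  have "structure_of ` maurer_cartan scale concentrated0 = {(m, P). nijenhuis_algebra scale m P}"
  proof (intro set_eqI iffI; clarify)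
    fix b R m P
    assume mc: "(b, R) \<in> maurer_cartan scale concentrated0" and eq: "(m, P) = structure_of (b, R)"
    then obtain B Q where BQ: "(b, R) = (bilinear_cochain B, linear_cochain Q)"
        "bilinear_map scale B" "Vector_Spaces.linear scale scale Q"
      using sub C_NjA_cases[OF assms] by (metis subsetD)
    with mc eq show "nijenhuis_algebra scale m P"
      using maurer_cartan_iff_nijenhuis[OF assms BQ(2,3)] by (simp add: structure_of_cochains)
  next
    fix m P
    assume N: "nijenhuis_algebra scale m P"
    then have "(bilinear_cochain m, linear_cochain P) \<in> maurer_cartan scale concentrated0"
      using maurer_cartan_iff_nijenhuis[OF assms] by (simp add: nijenhuis_algebra_def)
    then show "(m, P) \<in> structure_of ` maurer_cartan scale concentrated0"
      by (metis image_eqI structure_of_cochains)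
  qed
  with bij sub show "bij_betw structure_of (maurer_cartan scale concentrated0)
      {(m, P). nijenhuis_algebra scale m P}"
    by (rule bij_betw_subset)
qed

end
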